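(* There exists a (deterministic) locally finite infinite tree $T$ with root $o$ and $p_c(T)=1/2$ such that, for Bernoulli bond percolation on $T$, the percolation density $\theta(p)=\theta_{o,T}(p)$ is nowhere analytic on the interval $(p_c(T),1]$. In fact, $\theta$ is not differentiable at any $p\in(p_c(T),1)\cap\mathbb{Q}$.
   Context: In Bernoulli bond percolation with parameter $p$ each edge of $T$ is independently occupied with probability $p$ and vacant otherwise; $\Pr_p$ is the law. $C(o)$ is the connected component of $o$ in the subgraph of occupied edges, $\theta_{o,T}(p):=\Pr_p(|C(o)|=\infty)$ and $p_c(T):=\sup\{p : \theta_{o,T}(p)=0\}$. A function $f$ on an interval $I\subset\mathbb{R}$ is analytic at $x\in I$ if $x$ is the centre of an open disc $D\subset\mathbb{C}$ on which there is a holomorphic function agreeing with $f$ on $D\cap I$; nowhere analytic means analytic at no point of the interval. *)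

theory Defs
  imports "HOL-Probability.Probability" "HOL-Complex_Analysis.Complex_Analysis"
begin

(* A simple undirected graph is a vertex set V with a set E of two-element subsets of V. *)

definition simple_graph :: "'a set \<Rightarrow> 'a set set \<Rightarrow> bool" where
  "simple_graph V E \<longleftrightarrow> (\<forall>e\<in>E. e \<subseteq> V \<and> card e = 2)"

definition adj :: "'a set set \<Rightarrow> ('a \<times> 'a) set" where
  "adj E = {(u, v). {u, v} \<in> E}"

definition component :: "'a set set \<Rightarrow> 'a \<Rightarrow> 'a set" where
  "component E v = {u. (v, u) \<in> (adj E)\<^sup>*}"

definition connected_graph :: "'a set \<Rightarrow> 'a set set \<Rightarrow> bool" where
  "connected_graph V E \<longleftrightarrow> V \<noteq> {} \<and> (\<forall>u\<in>V. \<forall>v\<in>V. (u, v) \<in> (adj E)\<^sup>*)"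

definition is_cycle :: "'a set set \<Rightarrow> 'a list \<Rightarrow> bool" where
  "is_cycle E xs \<longleftrightarrow> 3 \<le> length xs \<and> distinct xs \<and>
     (\<forall>i<length xs. {xs ! i, xs ! (Suc i mod length xs)} \<in> E)"

definition is_tree :: "'a set \<Rightarrow> 'a set set \<Rightarrow> bool" where
  "is_tree V E \<longleftrightarrow> simple_graph V E \<and> connected_graph V E \<and> (\<nexists>xs. is_cycle E xs)"

definition locally_finite_graph :: "'a set \<Rightarrow> 'a set set \<Rightarrow> bool" where
  "locally_finite_graph V E \<longleftrightarrow> (\<forall>v\<in>V. finite {e \<in> E. v \<in> e})"

(* The library truncates the parameter of bernoulli_pmf to [0,1], so this is
   Bernoulli(p) percolation only for p in [0,1]. *)

definition bond_percolation :: "'a set set \<Rightarrow> real \<Rightarrow> ('a set \<Rightarrow> bool) measure" where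
  "bond_percolation E p = (\<Pi>\<^sub>M e\<in>E. measure_pmf (bernoulli_pmf p))"

definition occupied :: "'a set set \<Rightarrow> ('a set \<Rightarrow> bool) \<Rightarrow> 'a set set" where
  "occupied E \<omega> = {e \<in> E. \<omega> e}"

definition cluster :: "'a set set \<Rightarrow> ('a set \<Rightarrow> bool) \<Rightarrow> 'a \<Rightarrow> 'a set" where
  "cluster E \<omega> v = component (occupied E \<omega>) v"

definition percolation_density :: "'a set set \<Rightarrow> 'a \<Rightarrow> real \<Rightarrow> real" where
  "percolation_density E v p = \<P>(\<omega> in bond_percolation E p. infinite (cluster E \<omega> v))"

definition critical_prob :: "'a set set \<Rightarrow> 'a \<Rightarrow> real" where
  "critical_prob E v = Sup {p \<in> {0..1}. percolation_density E v p = 0}"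

(* Analyticity relative to an interval: at an endpoint belonging to I, the holomorphic
   function has to agree with f on the side of I only. *)

definition analytic_at_within :: "(real \<Rightarrow> real) \<Rightarrow> real set \<Rightarrow> real \<Rightarrow> bool" where
  "analytic_at_within f I x \<longleftrightarrow>
     (\<exists>r>0. \<exists>g :: complex \<Rightarrow> complex. g holomorphic_on ball (complex_of_real x) r \<and>
        (\<forall>y\<in>I. complex_of_real y \<in> ball (complex_of_real x) r \<longrightarrow>
           g (complex_of_real y) = complex_of_real (f y)))"

definition nowhere_analytic_on :: "(real \<Rightarrow> real) \<Rightarrow> real set \<Rightarrow> bool" where
  "nowhere_analytic_on f I \<longleftrightarrow> (\<forall>x\<in>I. \<not> analytic_at_within f I x)"

end

(* For 0 < q < 1 let T_q be a spherically symmetric tree whose level sizes grow like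
   n^2 / q^n.  By a first moment bound there is no percolation on T_q at p < q, whereas the
   summability of 1 / (q^n |level n|) gives percolation at p = q: the density of T_q jumps at q.
   Enumerate the rationals of (1/2, 1) as q_0, q_1, ... and attach T_(q_k) to the k-th vertex of
   a ray.  The density theta of this tree is monotone, vanishes up to 1/2 (no branch percolates,
   nor does the ray), is positive above, and inherits the jump at every q_k.  Since the jumps are
   dense in (1/2, 1), theta is not even continuous on any subinterval, hence nowhere analytic. *)

theory Submission imports Defs begin

section \<open>Independence in product measures\<close>

text \<open>Local finiteness forbids hanging infinitely many branches at one vertex, hence the ray.
  Seen from the root, the jump of branch \<open>k\<close> is then filtered through \<open>k\<close>
  ray edges and the earlier branches. It survives, shrunk by a positive factor, for two reasons: all
  other contributions are monotone in \<open>p\<close>, so none can offset it, and for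
  \<open>p < 1\<close> no branch percolates with probability one, so the outcome of branch
  \<open>k\<close> keeps mattering. The factor \<open>n^2\<close> is what produces a jump: it is
  subexponential, so the threshold stays \<open>q\<close>, but it makes the reciprocals summable;
  the bare growth \<open>1 / q^n\<close> would give a divergent series. Measure theory enters only
  to show that the probability of an occupied downward path of length \<open>n\<close> obeys a
  finite product recursion over the children, and that the density is the limit of these
  probabilities. From there on, the argument is about explicit real sequences that decrease in
  \<open>n\<close>.\<close>

lemma (in product_prob_space) indep_vars_coordinates:
  "P.indep_vars M (\<lambda>i \<omega>. \<omega> i) I"
proof (cases "I = {}")
  case True
  then show ?thesis unfolding P.indep_vars_def P.indep_sets_def by simp
next
  case False
  have "distr (PiM I M) (PiM I M) (\<lambda>\<omega>. \<lambda>i\<in>I. \<omega> i) = distr (PiM I M) (PiM I M) (\<lambda>\<omega>. \<omega>)"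
    by (intro distr_cong) (auto simp: space_PiM)
  also have "\<dots> = (\<Pi>\<^sub>M i\<in>I. distr (PiM I M) (M i) (\<lambda>\<omega>. \<omega> i))"
    by (subst distr_id2) (auto intro!: PiM_cong simp: PiM_component)
  finally show ?thesis
    using False by (subst P.indep_vars_iff_distr_eq_PiM') auto
qed

text \<open>Events living on disjoint blocks of coordinates are independent. Each \<open>Q l\<close>
  is a predicate on total functions, so it can be read both on the block \<open>K l\<close> and on
  all of \<open>I\<close>; \<open>supp\<close> makes the two readings agree.\<close>

lemma (in product_prob_space) prob_all_disjoint_support:
  assumes "finite L"
    and K: "\<And>l. l \<in> L \<Longrightarrow> K l \<subseteq> I" "disjoint_family_on K L"
    and meas: "\<And>l. l \<in> L \<Longrightarrow> Measurable.pred (PiM (K l) M) (Q l)"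
    and supp: "\<And>l \<omega> \<omega>'. l \<in> L \<Longrightarrow> (\<And>k. k \<in> K l \<Longrightarrow> \<omega> k = \<omega>' k) \<Longrightarrow> Q l \<omega> = Q l \<omega>'"
  shows "P.prob {\<omega> \<in> space (PiM I M). \<forall>l\<in>L. Q l \<omega>} =
    (\<Prod>l\<in>L. P.prob {\<omega> \<in> space (PiM I M). Q l \<omega>})"
proof (cases "L = {}")
  case True
  then show ?thesis by (simp add: P.prob_space)
next
  case False
  have *: "Q l (\<lambda>k\<in>K l. \<omega> k) = Q l \<omega>" if "l \<in> L" for l \<omega>
    using that by (intro supp) auto
  have "P.indep_vars (\<lambda>_. count_space UNIV) (\<lambda>l \<omega>. Q l (\<lambda>k\<in>K l. \<omega> k)) L"
    by (intro P.indep_vars_compose2[OF P.indep_vars_restrict[OF indep_vars_coordinates K]] meas)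
  then have "P.prob (\<Inter>l\<in>L. (\<lambda>\<omega>. Q l (\<lambda>k\<in>K l. \<omega> k)) -` {True} \<inter> space (PiM I M)) =
    (\<Prod>l\<in>L. P.prob ((\<lambda>\<omega>. Q l (\<lambda>k\<in>K l. \<omega> k)) -` {True} \<inter> space (PiM I M)))"
    using False assms(1) by (intro P.indep_varsD_finite) auto
  also have "(\<Inter>l\<in>L. (\<lambda>\<omega>. Q l (\<lambda>k\<in>K l. \<omega> k)) -` {True} \<inter> space (PiM I M)) =
    {\<omega> \<in> space (PiM I M). \<forall>l\<in>L. Q l \<omega>}"
    using False by (auto simp: *)
  also have "(\<Prod>l\<in>L. P.prob ((\<lambda>\<omega>. Q l (\<lambda>k\<in>K l. \<omega> k)) -` {True} \<inter> space (PiM I M))) =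
    (\<Prod>l\<in>L. P.prob {\<omega> \<in> space (PiM I M). Q l \<omega>})"
    by (intro prod.cong refl arg_cong[where f = P.prob]) (auto simp: *)
  finally show ?thesis .
qed

section \<open>Rooted trees\<close>

text \<open>Parent pointers instead of an edge set: every vertex other than the root owns exactly
  one edge, the one to its parent. The height, rising by one along each edge, yields both
  connectedness and acyclicity.\<close>

locale rooted_tree =
  fixes V :: "'a set" and root :: 'a and par :: "'a \<Rightarrow> 'a" and ht :: "'a \<Rightarrow> nat"
  assumes root_in: "root \<in> V"
    and ht_root: "ht root = 0"
    and par_in: "v \<in> V \<Longrightarrow> v \<noteq> root \<Longrightarrow> par v \<in> V"
    and ht_par: "v \<in> V \<Longrightarrow> v \<noteq> root \<Longrightarrow> ht v = Suc (ht (par v))"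
    and finite_children: "v \<in> V \<Longrightarrow> finite {w \<in> V - {root}. par w = v}"
begin

definition children :: "'a \<Rightarrow> 'a set" where
  "children v = {w \<in> V - {root}. par w = v}"

definition edges :: "'a set set" where
  "edges = (\<lambda>w. {w, par w}) ` (V - {root})"

lemma children_in: "w \<in> children v \<Longrightarrow> w \<in> V"
  and children_par: "w \<in> children v \<Longrightarrow> par w = v"
  and children_ht: "w \<in> children v \<Longrightarrow> ht w = Suc (ht v)"
  and children_edge: "w \<in> children v \<Longrightarrow> {w, v} \<in> edges"
  using ht_par by (auto simp: children_def edges_def)

lemma edges_cases:
  assumes "{u, v} \<in> edges"
  obtains "u \<in> children v" | "v \<in> children u"
proof -
  obtain w where "w \<in> V - {root}" "{u, v} = {w, par w}"
    using assms by (auto simp: edges_def)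
  then have "u \<in> children v \<or> v \<in> children u"
    by (auto simp: children_def doubleton_eq_iff)
  then show thesis using that by blast
qed

text \<open>Otherwise \<open>u\<close> and \<open>u'\<close> would be each other's parents, each one
  higher than the other.\<close>

lemma edge_inj:
  assumes "u \<in> V - {root}" "u' \<in> V - {root}" "{u, par u} = {u', par u'}"
  shows "u = u'"
  using assms ht_par[of u] ht_par[of u'] by (auto simp: doubleton_eq_iff)

lemma simple_edges: "simple_graph V edges"
  unfolding simple_graph_def
proof
  fix e assume "e \<in> edges"
  then obtain w where w: "w \<in> V" "w \<noteq> root" "e = {w, par w}" by (auto simp: edges_def)
  then have "w \<noteq> par w" using ht_par[of w] by auto
  then show "e \<subseteq> V \<and> card e = 2" using w par_in by auto
qed

lemma adj_sym: "(u, v) \<in> adj F \<longleftrightarrow> (v, u) \<in> adj F"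
  by (simp add: adj_def insert_commute)

lemma connected_to_root: "v \<in> V \<Longrightarrow> (v, root) \<in> (adj edges)\<^sup>*"
proof (induction "ht v" arbitrary: v rule: less_induct)
  case less
  show ?case
  proof (cases "v = root")
    case False
    then have "(v, par v) \<in> adj edges" using less.prems by (auto simp: adj_def edges_def)
    moreover have "(par v, root) \<in> (adj edges)\<^sup>*"
      using less False ht_par par_in by simp
    ultimately show ?thesis by (rule converse_rtrancl_into_rtrancl)
  qed simp
qed

lemma connected_edges: "connected_graph V edges"
  unfolding connected_graph_def
proof (intro conjI ballI)
  show "V \<noteq> {}" using root_in by auto
  fix u v assume "u \<in> V" "v \<in> V"
  have "sym ((adj edges)\<^sup>*)" by (intro sym_rtrancl symI) (simp add: adj_sym)
  then have "(root, v) \<in> (adj edges)\<^sup>*"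
    using connected_to_root[OF \<open>v \<in> V\<close>] by (auto dest: symD)
  with connected_to_root[OF \<open>u \<in> V\<close>] show "(u, v) \<in> (adj edges)\<^sup>*" by simp
qed

text \<open>A vertex of maximal height on a cycle would have its parent as both neighbours.\<close>

lemma acyclic_edges: "\<not> is_cycle edges xs"
proof
  assume cyc: "is_cycle edges xs"
  define l where "l = length xs"
  have l: "3 \<le> l" "distinct xs" and
    step: "\<And>i. i < l \<Longrightarrow> {xs ! i, xs ! (Suc i mod l)} \<in> edges"
    using cyc by (auto simp: is_cycle_def l_def)
  define m where "m = Max ((\<lambda>i. ht (xs ! i)) ` {..<l})"
  have "m \<in> (\<lambda>i. ht (xs ! i)) ` {..<l}"
    unfolding m_def using l(1) by (intro Max_in) (auto simp: lessThan_empty_iff bot_nat_def)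
  then obtain i where i: "i < l" "ht (xs ! i) = m" by auto
  have mx: "ht (xs ! j) \<le> ht (xs ! i)" if "j < l" for j
    using that unfolding i(2) m_def by (intro Max_ge) auto
  have up: "xs ! j = par (xs ! i)" if "{xs ! i, xs ! j} \<in> edges" "j < l" for j
    using that(1)
  proof (cases rule: edges_cases)
    case 2
    then show ?thesis using mx[OF that(2)] children_ht by fastforce
  qed (simp add: children_par)
  define a where "a = Suc i mod l"
  define b where "b = (if i = 0 then l - 1 else i - 1)"
  have ab: "a < l" "b < l" using i l by (auto simp: a_def b_def)
  have "Suc b mod l = i" using i l by (auto simp: b_def)
  then have "xs ! a = par (xs ! i)" "xs ! b = par (xs ! i)"
    using up[of a] up[of b] step[of i] step[of b] ab i by (auto simp: a_def insert_commute)
  then have "a = b" using l ab by (metis l_def nth_eq_iff_index_eq)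
  \<comment> \<open>Cyclic successor and predecessor of an index differ because the length is at
    least 3; the case split treats the wrap-around.\<close>
  then show False using i l by (cases "Suc i = l") (auto simp: a_def b_def split: if_splits)
qed

lemma tree_edges: "is_tree V edges"
  using simple_edges connected_edges acyclic_edges by (simp add: is_tree_def)

lemma locally_finite_edges: "locally_finite_graph V edges"
  unfolding locally_finite_graph_def
proof
  fix v assume v: "v \<in> V"
  have "{e \<in> edges. v \<in> e} \<subseteq> insert {v, par v} ((\<lambda>w. {w, par w}) ` children v)"
    by (auto simp: edges_def children_def)
  then show "finite {e \<in> edges. v \<in> e}"
    by (rule finite_subset) (use finite_children[OF v] in \<open>simp add: children_def\<close>)
qed

lemma finite_level: "finite {v \<in> V. ht v = n}"
proof (induction n)
  case 0
  have "{v \<in> V. ht v = 0} \<subseteq> {root}" using ht_par by force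
  then show ?case by (rule finite_subset) simp
next
  case (Suc n)
  have "{v \<in> V. ht v = Suc n} \<subseteq> (\<Union>u\<in>{u \<in> V. ht u = n}. children u)"
  proof
    fix v assume v: "v \<in> {v \<in> V. ht v = Suc n}"
    then have "v \<noteq> root" using ht_root by auto
    with v have "v \<in> children (par v)" "par v \<in> V" "ht (par v) = n"
      using ht_par[of v] par_in[of v] by (auto simp: children_def)
    then show "v \<in> (\<Union>u\<in>{u \<in> V. ht u = n}. children u)" by blast
  qed
  moreover have "finite (\<Union>u\<in>{u \<in> V. ht u = n}. children u)"
    using Suc finite_children by (auto simp: children_def)
  ultimately show ?case by (rule finite_subset)
qed

section \<open>Percolation down to a given level\<close>

text \<open>Existence of an occupied path of \<open>n\<close> edges leading away from the root.
  Unlike infinity of the cluster, it involves only finitely many edges and splits over the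
  children.\<close>

primrec descends :: "nat \<Rightarrow> 'a \<Rightarrow> ('a set \<Rightarrow> bool) \<Rightarrow> bool" where
  "descends 0 v \<omega> \<longleftrightarrow> True"
| "descends (Suc n) v \<omega> \<longleftrightarrow> (\<exists>w\<in>children v. \<omega> {w, v} \<and> descends n w \<omega>)"

lemma descends_Suc_imp: "descends (Suc n) v \<omega> \<Longrightarrow> descends n v \<omega>"
proof (induction n arbitrary: v)
  case (Suc n)
  then obtain w where "w \<in> children v" "\<omega> {w, v}" "descends (Suc n) w \<omega>"
    by (metis descends.simps(2))
  then show ?case using Suc.IH by (metis descends.simps(2))
qed simp

lemma descends_antimono: "n \<le> m \<Longrightarrow> descends m v \<omega> \<Longrightarrow> descends n v \<omega>"
  by (induction rule: dec_induct) (use descends_Suc_imp in blast)+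


inductive_set down_cluster :: "('a set \<Rightarrow> bool) \<Rightarrow> 'a set" for \<omega> where
  root: "root \<in> down_cluster \<omega>"
| child: "v \<in> down_cluster \<omega> \<Longrightarrow> w \<in> children v \<Longrightarrow> \<omega> {w, v} \<Longrightarrow> w \<in> down_cluster \<omega>"

text \<open>Going up never reaches anything new: parents are unique, so a step up from a vertex
  returns to the one through which it was entered.\<close>

lemma cluster_eq_down_cluster: "cluster edges \<omega> root = down_cluster \<omega>"
proof (intro equalityI subsetI)
  fix u assume "u \<in> cluster edges \<omega> root"
  then have "(root, u) \<in> (adj (occupied edges \<omega>))\<^sup>*"
    by (simp add: cluster_def component_def)
  then show "u \<in> down_cluster \<omega>"
  proof (induction rule: rtrancl_induct)
    case base
    show ?case by (rule down_cluster.root)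
  next
    case (step u v)
    have uv: "{u, v} \<in> edges" "\<omega> {u, v}" using step.hyps by (auto simp: adj_def occupied_def)
    from uv(1) show ?case
    proof (cases rule: edges_cases)
      case 1
      from step.IH show ?thesis
      proof cases
        case root
        then show ?thesis using 1 by (simp add: children_def)
      next
        case (child x)
        then show ?thesis using 1 by (simp add: children_def)
      qed
    next
      case 2
      then show ?thesis using down_cluster.child[OF step.IH] uv(2) by (simp add: insert_commute)
    qed
  qed
next
  fix u assume "u \<in> down_cluster \<omega>"
  then show "u \<in> cluster edges \<omega> root"
  proof induction
    case (child v w)
    then have "(v, w) \<in> adj (occupied edges \<omega>)"
      using children_edge[of w v] by (simp add: adj_def occupied_def insert_commute)
    then show ?case using child.IH by (auto simp: cluster_def component_def)
  qed (simp add: cluster_def component_def)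
qed

lemma down_cluster_in: "u \<in> down_cluster \<omega> \<Longrightarrow> u \<in> V"
  by (induction rule: down_cluster.induct) (auto simp: root_in children_in)

lemma descends_imp_ex:
  "v \<in> down_cluster \<omega> \<Longrightarrow> descends n v \<omega> \<Longrightarrow> \<exists>u\<in>down_cluster \<omega>. ht u = ht v + n"
proof (induction n arbitrary: v)
  case (Suc n)
  then obtain w where w: "w \<in> children v" "\<omega> {w, v}" "descends n w \<omega>" by auto
  then have "w \<in> down_cluster \<omega>" using Suc.prems down_cluster.child by blast
  then show ?case using Suc.IH[of w] w children_ht[of w v] by auto
qed auto

lemma down_cluster_descends:
  "u \<in> down_cluster \<omega> \<Longrightarrow> descends m u \<omega> \<Longrightarrow> descends (ht u + m) root \<omega>"
proof (induction arbitrary: m rule: down_cluster.induct)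
  case (child v w)
  then have "descends (Suc m) v \<omega>" by auto
  from child.IH[OF this] show ?case using children_ht[OF child.hyps(2)] by simp
qed (simp add: ht_root)

text \<open>Levels are finite, so an infinite cluster has vertices of unbounded height; conversely,
  unbounded descent puts a vertex of every height into the cluster. The paths for different
  \<open>n\<close> need not extend one another. Infinity of the cluster thus becomes a decreasing
  intersection of finitely determined events.\<close>

lemma infinite_cluster_iff: "infinite (cluster edges \<omega> root) \<longleftrightarrow> (\<forall>n. descends n root \<omega>)"
proof
  assume inf: "infinite (cluster edges \<omega> root)"
  show "\<forall>n. descends n root \<omega>"
  proof
    fix n
    have "finite (\<Union>m<n. {v \<in> V. ht v = m})" using finite_level by simp
    then have "\<not> down_cluster \<omega> \<subseteq> (\<Union>m<n. {v \<in> V. ht v = m})"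
      using inf unfolding cluster_eq_down_cluster by (metis finite_subset)
    then obtain u where "u \<in> down_cluster \<omega>" "n \<le> ht u"
      using down_cluster_in by fastforce
    then show "descends n root \<omega>"
      using down_cluster_descends[where m = 0] descends_antimono[of n "ht u"] by simp
  qed
next
  assume "\<forall>n. descends n root \<omega>"
  then have "\<exists>u\<in>down_cluster \<omega>. ht u = n" for n
    using descends_imp_ex[OF down_cluster.root] ht_root by auto
  then have "ht ` down_cluster \<omega> = UNIV" by (metis UNIV_eq_I imageI)
  then show "infinite (cluster edges \<omega> root)"
    unfolding cluster_eq_down_cluster using finite_imageI infinite_UNIV_nat by metis
qed

text \<open>The edges owned by \<open>w\<close> and its descendants, hence including the edge from
  \<open>w\<close> up to its parent. The height condition guards against truncated subtraction in
  the exponent.\<close>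

definition edges_below :: "'a \<Rightarrow> 'a set set" where
  "edges_below w = (\<lambda>u. {u, par u}) `
     {u \<in> V - {root}. ht w \<le> ht u \<and> (par ^^ (ht u - ht w)) u = w}"

lemma edges_below_subset: "edges_below w \<subseteq> edges"
  by (auto simp: edges_below_def edges_def)

lemma edges_below_self: "w \<in> children v \<Longrightarrow> {w, v} \<in> edges_below w"
  by (auto simp: edges_below_def children_def)

lemma edges_below_child:
  assumes "w \<in> children v" shows "edges_below w \<subseteq> edges_below v"
proof -
  have "(par ^^ (ht u - ht v)) u = v"
    if "ht w \<le> ht u" "(par ^^ (ht u - ht w)) u = w" for u
  proof -
    have "ht u - ht v = Suc (ht u - ht w)" using that children_ht[OF assms] by simp
    then show ?thesis using that children_par[OF assms] by simp
  qed
  then show ?thesis using children_ht[OF assms] by (force simp: edges_below_def)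
qed

lemma edges_below_disjoint:
  assumes "ht w = ht w'" "w \<noteq> w'" shows "edges_below w \<inter> edges_below w' = {}"
proof (rule ccontr)
  assume "edges_below w \<inter> edges_below w' \<noteq> {}"
  then obtain u u' where u: "u \<in> V - {root}" "(par ^^ (ht u - ht w)) u = w"
    "u' \<in> V - {root}" "(par ^^ (ht u' - ht w')) u' = w'" "{u, par u} = {u', par u'}"
    unfolding edges_below_def by blast
  then have "u = u'" using edge_inj by blast
  then show False using u(2,4) assms by metis
qed

lemma edge_notin_below_child:
  assumes "w \<in> children v" "x \<in> children w" shows "{w, v} \<notin> edges_below x"
proof
  assume "{w, v} \<in> edges_below x"
  then obtain u where u: "u \<in> V - {root}" "ht x \<le> ht u" "{w, v} = {u, par u}"
    by (auto simp: edges_below_def)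
  have "w = u" using u assms by (intro edge_inj) (auto simp: children_def)
  then show False using u(2) children_ht[OF assms(2)] by simp
qed

text \<open>The support is described through the children of \<open>v\<close> rather than as
  \<open>edges_below v\<close>: the edge above \<open>v\<close> has to stay outside, so that its
  state is independent of the descent from \<open>v\<close>.\<close>

lemma descends_cong:
  "(\<And>x e. x \<in> children v \<Longrightarrow> e \<in> edges_below x \<Longrightarrow> \<omega> e = \<omega>' e) \<Longrightarrow>
     descends n v \<omega> = descends n v \<omega>'"
proof (induction n arbitrary: v)
  case (Suc n)
  have "descends n w \<omega> = descends n w \<omega>'" if "w \<in> children v" for w
    using that edges_below_child by (intro Suc.IH Suc.prems[of w]) auto
  moreover have "\<omega> {w, v} = \<omega>' {w, v}" if "w \<in> children v" for w
    using that by (intro Suc.prems[of w] edges_below_self)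
  ultimately show ?case by auto
qed simp

text \<open>The index set \<open>J\<close> varies because measurability is wanted on the full
  product and on the blocks of edges entering the independence argument.\<close>

lemma pred_descends:
  assumes "v \<in> V" "\<And>x. x \<in> children v \<Longrightarrow> edges_below x \<subseteq> J"
  shows "Measurable.pred (PiM J (\<lambda>_. measure_pmf q)) (descends n v)"
  using assms
proof (induction n arbitrary: v)
  case (Suc n)
  have "finite (children v)" using finite_children[OF Suc.prems(1)] by (simp add: children_def)
  moreover have "Measurable.pred (PiM J (\<lambda>_. measure_pmf q)) (\<lambda>\<omega>. \<omega> {w, v})"
    "Measurable.pred (PiM J (\<lambda>_. measure_pmf q)) (descends n w)" if "w \<in> children v" for w
  proof -
    have "{w, v} \<in> J" using Suc.prems(2) edges_below_self that by blast
    from measurable_component_singleton[OF this, of "\<lambda>_. measure_pmf q"]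
    show "Measurable.pred (PiM J (\<lambda>_. measure_pmf q)) (\<lambda>\<omega>. \<omega> {w, v})" by simp
    show "Measurable.pred (PiM J (\<lambda>_. measure_pmf q)) (descends n w)"
      using that Suc.prems(2) edges_below_child children_in by (intro Suc.IH) blast+
  qed
  ultimately show ?case by (simp add: pred_intros_finite pred_intros_logic)
next
  case 0
  have "descends 0 v = (\<lambda>_. True)" by auto
  then show ?case by simp
qed

section \<open>The recursion for descent probabilities and its limit\<close>

primrec reach :: "real \<Rightarrow> nat \<Rightarrow> 'a \<Rightarrow> real" where
  "reach p 0 v = 1"
| "reach p (Suc n) v = 1 - (\<Prod>w\<in>children v. 1 - p * reach p n w)"

text \<open>Descent from \<open>v\<close> fails iff it fails through every child, and these failures
  depend on disjoint sets of edges. Through one child \<open>w\<close>, success needs the edge above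
  \<open>w\<close> and descent from \<open>w\<close>, again with disjoint supports. Independence is
  thus used twice.\<close>

lemma prob_descends:
  assumes p: "0 \<le> p" "p \<le> 1" and "v \<in> V"
  shows "\<P>(\<omega> in bond_percolation edges p. descends n v \<omega>) = reach p n v"
  using assms(3)
proof (induction n arbitrary: v)
  case 0
  interpret product_prob_space "\<lambda>_. measure_pmf (bernoulli_pmf p)" edges
    by (intro product_prob_spaceI measure_pmf.prob_space_axioms)
  show ?case by (simp add: bond_percolation_def P.prob_space)
next
  case (Suc n)
  interpret product_prob_space "\<lambda>_. measure_pmf (bernoulli_pmf p)" edges
    by (intro product_prob_spaceI measure_pmf.prob_space_axioms)
  let ?N = "\<lambda>_. measure_pmf (bernoulli_pmf p)"
  let ?M = "PiM edges ?N"
  have fin: "finite (children v)" using finite_children[OF Suc.prems] by (simp add: children_def)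
  have coord: "Measurable.pred (PiM J ?N) (\<lambda>\<omega>. \<omega> e)" if "e \<in> J" for J e
    using measurable_component_singleton[OF that, of ?N] by simp
  have coord_prob: "P.prob {\<omega> \<in> space ?M. \<omega> e} = p" if "e \<in> edges" for e
  proof -
    have "p = measure (measure_pmf (bernoulli_pmf p)) {True}"
      using p by (simp add: measure_pmf_single)
    also have "\<dots> = measure (distr ?M (measure_pmf (bernoulli_pmf p)) (\<lambda>\<omega>. \<omega> e)) {True}"
      using PiM_component[OF that] by simp
    also have "\<dots> = P.prob {\<omega> \<in> space ?M. \<omega> e}"
      using that by (subst measure_distr) (auto intro!: arg_cong[where f = P.prob])
    finally show ?thesis by simp
  qed
  have child: "P.prob {\<omega> \<in> space ?M. \<omega> {w, v} \<and> descends n w \<omega>} = p * reach p n w"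
    and child_meas: "{\<omega> \<in> space ?M. \<omega> {w, v} \<and> descends n w \<omega>} \<in> P.events"
    if w: "w \<in> children v" for w
  proof -
    \<comment> \<open>A family indexed by \<open>bool\<close>: \<open>True\<close> stands for the
      edge above \<open>w\<close>, \<open>False\<close> for the descent from
      \<open>w\<close>.\<close>
    define K where "K b = (if b then {{w, v}} else (\<Union>x\<in>children w. edges_below x))" for b
    define Q where "Q b = (if b then (\<lambda>\<omega>. \<omega> {w, v}) else descends n w)" for b
    have "P.prob {\<omega> \<in> space ?M. \<forall>b\<in>UNIV. Q b \<omega>} = (\<Prod>b\<in>UNIV. P.prob {\<omega> \<in> space ?M. Q b \<omega>})"
    proof (rule prob_all_disjoint_support)
      show "disjoint_family_on K UNIV"
        using edge_notin_below_child[OF w] by (auto simp: disjoint_family_on_def K_def)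
      show "K b \<subseteq> edges" for b
        using children_edge[OF w] edges_below_subset by (auto simp: K_def)
      show "Measurable.pred (PiM (K b) ?N) (Q b)" for b
      proof (cases b)
        case False
        then show ?thesis unfolding K_def Q_def
          using children_in[OF w] by (auto intro!: pred_descends)
      qed (auto simp: K_def Q_def intro: coord)
      show "Q b \<omega> = Q b \<omega>'" if "\<And>k. k \<in> K b \<Longrightarrow> \<omega> k = \<omega>' k" for b \<omega> \<omega>'
      proof (cases b)
        case False
        then show ?thesis using that unfolding K_def Q_def by (auto intro!: descends_cong)
      qed (use that in \<open>auto simp: K_def Q_def\<close>)
    qed simp
    moreover have "(\<forall>b\<in>UNIV. Q b \<omega>) \<longleftrightarrow> \<omega> {w, v} \<and> descends n w \<omega>" for \<omega>
      by (auto simp: Q_def)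
    moreover have "P.prob {\<omega> \<in> space ?M. Q True \<omega>} = p"
      using coord_prob[OF children_edge[OF w]] by (simp add: Q_def)
    moreover have "P.prob {\<omega> \<in> space ?M. Q False \<omega>} = reach p n w"
      using Suc.IH[OF children_in[OF w]] by (simp add: Q_def bond_percolation_def)
    ultimately show "P.prob {\<omega> \<in> space ?M. \<omega> {w, v} \<and> descends n w \<omega>} = p * reach p n w"
      by (simp add: UNIV_bool)
    have "Measurable.pred ?M (descends n w)"
      using children_in[OF w] edges_below_subset by (intro pred_descends)
    then show "{\<omega> \<in> space ?M. \<omega> {w, v} \<and> descends n w \<omega>} \<in> P.events"
      using coord[OF children_edge[OF w]] by measurable
  qed
  define Q where "Q w \<omega> \<longleftrightarrow> \<not> (\<omega> {w, v} \<and> descends n w \<omega>)" for w \<omega>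
  have Q_prob: "P.prob {\<omega> \<in> space ?M. Q w \<omega>} = 1 - p * reach p n w" if "w \<in> children v" for w
    using P.prob_neg[OF child_meas[OF that]] child[OF that] by (simp add: Q_def)
  have "P.prob {\<omega> \<in> space ?M. \<forall>w\<in>children v. Q w \<omega>} =
    (\<Prod>w\<in>children v. P.prob {\<omega> \<in> space ?M. Q w \<omega>})"
  proof (rule prob_all_disjoint_support[where K = edges_below])
    show "disjoint_family_on edges_below (children v)"
      unfolding disjoint_family_on_def using edges_below_disjoint children_ht by metis
    show "edges_below w \<subseteq> edges" for w by (rule edges_below_subset)
    show "Measurable.pred (PiM (edges_below w) ?N) (Q w)" if "w \<in> children v" for w
    proof -
      have "Measurable.pred (PiM (edges_below w) ?N) (descends n w)"
        using that edges_below_child children_in by (intro pred_descends)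
      then show ?thesis
        unfolding Q_def using coord[OF edges_below_self[OF that]] by measurable
    qed
    show "Q w \<omega> = Q w \<omega>'"
      if "w \<in> children v" "\<And>k. k \<in> edges_below w \<Longrightarrow> \<omega> k = \<omega>' k" for w \<omega> \<omega>'
    proof -
      have "descends n w \<omega> = descends n w \<omega>'"
        using that edges_below_child by (intro descends_cong) blast
      then show ?thesis using that(2)[OF edges_below_self[OF that(1)]] by (simp add: Q_def)
    qed
  qed (rule fin)
  also have "\<dots> = (\<Prod>w\<in>children v. 1 - p * reach p n w)"
    by (intro prod.cong refl Q_prob)
  also have "{\<omega> \<in> space ?M. \<forall>w\<in>children v. Q w \<omega>} = {\<omega> \<in> space ?M. \<not> descends (Suc n) v \<omega>}"
    by (auto simp: Q_def)
  also have "P.prob \<dots> = 1 - P.prob {\<omega> \<in> space ?M. descends (Suc n) v \<omega>}"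
  proof (rule P.prob_neg)
    have "Measurable.pred ?M (descends (Suc n) v)"
      using Suc.prems edges_below_subset by (intro pred_descends)
    then show "{\<omega> \<in> space ?M. descends (Suc n) v \<omega>} \<in> P.events" by measurable
  qed
  finally show ?case by (simp add: bond_percolation_def)
qed

text \<open>Continuity from above. This is the only bridge from the probability space to the real
  recursions below.\<close>

lemma density_LIMSEQ:
  assumes p: "0 \<le> p" "p \<le> 1"
  shows "(\<lambda>n. reach p n root) \<longlonglongrightarrow> percolation_density edges root p"
proof -
  interpret product_prob_space "\<lambda>_. measure_pmf (bernoulli_pmf p)" edges
    by (intro product_prob_spaceI measure_pmf.prob_space_axioms)
  let ?M = "bond_percolation edges p"
  let ?A = "\<lambda>n. {\<omega> \<in> space ?M. descends n root \<omega>}"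
  have "?A n \<in> sets ?M" for n
  proof -
    have "Measurable.pred ?M (descends n root)"
      unfolding bond_percolation_def
      using root_in edges_below_subset by (intro pred_descends)
    then show ?thesis by measurable
  qed
  then have "range ?A \<subseteq> sets ?M" by blast
  moreover have "decseq ?A" using descends_antimono by (auto simp: decseq_def)
  ultimately have "(\<lambda>n. measure ?M (?A n)) \<longlonglongrightarrow> measure ?M (\<Inter>n. ?A n)"
    unfolding bond_percolation_def by (rule P.finite_Lim_measure_decseq)
  moreover have "(\<Inter>n. ?A n) = {\<omega> \<in> space ?M. infinite (cluster edges \<omega> root)}"
    by (auto simp: infinite_cluster_iff)
  ultimately show ?thesis
    by (simp add: prob_descends[OF p root_in] percolation_density_def)
qed

end

section \<open>Spherically symmetric branches\<close>

text \<open>The level sizes \<open>B j\<close> are powers of two, hence divide one another, and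
  \<open>q ^ j * B j\<close> lies between \<open>(j + 1)\<^sup>2 / 2\<close> and \<open>(j + 1)\<^sup>2\<close>: exponential growth \<open>1 / q\<close>,
  but with \<open>1 / (q ^ j * B j)\<close> summable, so that there is percolation at \<open>q\<close> itself.\<close>

definition level_size :: "real \<Rightarrow> nat \<Rightarrow> nat" where
  "level_size q j = 2 ^ nat \<lfloor>log 2 ((real j + 1)\<^sup>2 / q ^ j)\<rfloor>"

definition branching :: "real \<Rightarrow> nat \<Rightarrow> nat" where
  "branching q j = level_size q (Suc j) div level_size q j"

lemma level_size_0 [simp]: "level_size q 0 = 1"
  by (simp add: level_size_def)

lemma level_size_pos [simp]: "0 < level_size q j"
  by (simp add: level_size_def)

context
  fixes q :: real
  assumes q: "0 < q" "q < 1"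
begin

lemma level_target_ge_1: "1 \<le> (real j + 1)\<^sup>2 / q ^ j"
proof -
  have "q ^ j \<le> 1" using q by (simp add: power_le_one)
  also have "1 \<le> (real j + 1)\<^sup>2" by (simp add: one_le_power)
  finally show ?thesis using q by simp
qed

lemma level_size_bounds:
  "real (level_size q j) \<le> (real j + 1)\<^sup>2 / q ^ j"
  "(real j + 1)\<^sup>2 / q ^ j / 2 < real (level_size q j)"
proof -
  let ?x = "(real j + 1)\<^sup>2 / q ^ j"
  let ?m = "\<lfloor>log 2 ?x\<rfloor>"
  have x: "1 \<le> ?x" by (rule level_target_ge_1)
  then have m: "0 \<le> ?m" by simp
  then have B: "real (level_size q j) = 2 powr real_of_int ?m"
    by (simp add: level_size_def powr_real_of_int)
  have "2 powr real_of_int ?m \<le> 2 powr log 2 ?x" by (intro powr_mono) auto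
  then show "real (level_size q j) \<le> ?x" using x B by simp
  have "2 powr log 2 ?x < 2 powr (real_of_int ?m + 1)" by (intro powr_less_mono) linarith+
  then show "?x / 2 < real (level_size q j)" using x B by (simp add: powr_add)
qed

lemma level_size_dvd: "level_size q j dvd level_size q (Suc j)"
proof -
  have "(real j + 1)\<^sup>2 / q ^ j \<le> (real (Suc j) + 1)\<^sup>2 / q ^ Suc j"
    using q by (intro frac_le power_mono power_decreasing) auto
  then have "log 2 ((real j + 1)\<^sup>2 / q ^ j) \<le> log 2 ((real (Suc j) + 1)\<^sup>2 / q ^ Suc j)"
    using level_target_ge_1[of j] by (subst log_le_cancel_iff) auto
  then show ?thesis
    unfolding level_size_def by (intro le_imp_power_dvd nat_mono floor_mono)
qed

lemma branching_mult: "level_size q j * branching q j = level_size q (Suc j)"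
  using level_size_dvd by (simp add: branching_def)

lemma branching_pos: "0 < branching q j"
  using branching_mult[of j] level_size_pos[of q "Suc j"] by (metis mult_0_right neq0_conv)

text \<open>Vertex \<open>i'\<close> of the next level will hang below
  \<open>i' mod level_size q j\<close>. Since level sizes divide one another, residue classes have
  equal size, which makes the branch spherically symmetric.\<close>

lemma card_level_fibre:
  assumes "i < level_size q j"
  shows "card {i' \<in> {..<level_size q (Suc j)}. i' mod level_size q j = i} = branching q j"
proof -
  let ?B = "level_size q j"
  have lt: "i + t * ?B < level_size q (Suc j)" if "t < branching q j" for t
  proof -
    have "Suc t * ?B \<le> branching q j * ?B" using that by (intro mult_right_mono) auto
    then show ?thesis using assms branching_mult[of j] by (simp add: mult.commute)
  qed
  have "bij_betw (\<lambda>t. i + t * ?B) {..<branching q j}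
    {i' \<in> {..<level_size q (Suc j)}. i' mod ?B = i}"
  proof (rule bij_betw_byWitness[where f' = "\<lambda>i'. i' div ?B"])
    show "(\<lambda>t. i + t * ?B) ` {..<branching q j} \<subseteq>
      {i' \<in> {..<level_size q (Suc j)}. i' mod ?B = i}"
      using assms lt by auto
    show "(\<lambda>i'. i' div ?B) ` {i' \<in> {..<level_size q (Suc j)}. i' mod ?B = i} \<subseteq> {..<branching q j}"
      using branching_mult[of j]
      by (auto simp: less_mult_imp_div_less mult.commute)
  qed (use assms in \<open>auto simp: mod_div_mult_eq\<close>)
  from bij_betw_same_card[OF this] show ?thesis by simp
qed

end

section \<open>Descent probabilities inside one branch\<close>

primrec branch_reach :: "real \<Rightarrow> real \<Rightarrow> nat \<Rightarrow> nat \<Rightarrow> real" where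
  "branch_reach q p 0 j = 1"
| "branch_reach q p (Suc n) j = 1 - (1 - p * branch_reach q p n (Suc j)) ^ branching q j"

text \<open>Bounds and monotonicity share one induction: comparing the powers requires
  \<open>1 - p * branch_reach q p n j\<close> to stay in the unit interval.\<close>

lemma branch_reach_mono:
  assumes "0 \<le> p" "p \<le> p'" "p' \<le> 1"
  shows "0 \<le> branch_reach q p n j \<and> branch_reach q p n j \<le> branch_reach q p' n j \<and>
    branch_reach q p' n j \<le> 1"
proof (induction n arbitrary: j)
  case (Suc n)
  let ?x = "p * branch_reach q p n (Suc j)" and ?y = "p' * branch_reach q p' n (Suc j)"
  have "0 \<le> ?x" "?x \<le> ?y" "?y \<le> 1"
    using Suc[of "Suc j"] assms by (auto intro!: mult_mono mult_le_one)
  then have "0 \<le> (1 - ?y) ^ branching q j" "(1 - ?y) ^ branching q j \<le> (1 - ?x) ^ branching q j"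
    "(1 - ?x) ^ branching q j \<le> 1"
    by (auto intro!: power_mono power_le_one)
  then show ?case by simp
qed simp

lemma branch_reach_nonneg: "0 \<le> p \<Longrightarrow> p \<le> 1 \<Longrightarrow> 0 \<le> branch_reach q p n j"
  and branch_reach_le_1: "0 \<le> p \<Longrightarrow> p \<le> 1 \<Longrightarrow> branch_reach q p n j \<le> 1"
  using branch_reach_mono[of p p q n j] by auto

lemma branch_reach_Suc_le:
  assumes "0 \<le> p" "p \<le> 1"
  shows "branch_reach q p (Suc n) j \<le> branch_reach q p n j"
proof (induction n arbitrary: j)
  case 0
  show ?case using branch_reach_le_1[OF assms, of q "Suc 0" j] by simp
next
  case (Suc n)
  have "p * branch_reach q p (Suc n) (Suc j) \<le> p * branch_reach q p n (Suc j)"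
    using Suc assms by (intro mult_left_mono)
  moreover have "p * branch_reach q p n (Suc j) \<le> 1"
    using assms branch_reach_nonneg branch_reach_le_1 by (intro mult_le_one) auto
  ultimately have "(1 - p * branch_reach q p n (Suc j)) ^ branching q j \<le>
    (1 - p * branch_reach q p (Suc n) (Suc j)) ^ branching q j"
    by (intro power_mono) auto
  then show ?case by (simp only: branch_reach.simps)
qed

definition branch_lim :: "real \<Rightarrow> real \<Rightarrow> real" where
  "branch_lim q p = lim (\<lambda>n. branch_reach q p n 0)"

lemma branch_reach_LIMSEQ:
  assumes "0 \<le> p" "p \<le> 1"
  shows "(\<lambda>n. branch_reach q p n 0) \<longlonglongrightarrow> branch_lim q p"
proof -
  have "decseq (\<lambda>n. branch_reach q p n 0)"
    using branch_reach_Suc_le[OF assms] by (intro decseq_SucI)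
  then have "convergent (\<lambda>n. branch_reach q p n 0)"
    using branch_reach_nonneg[OF assms] by (metis convergentI decseq_convergent)
  then show ?thesis by (simp add: branch_lim_def convergent_LIMSEQ_iff)
qed

lemma branch_lim_nonneg: "0 \<le> p \<Longrightarrow> p \<le> 1 \<Longrightarrow> 0 \<le> branch_lim q p"
  using branch_reach_LIMSEQ branch_reach_nonneg by (metis LIMSEQ_le_const)

lemma branch_lim_le_1: "0 \<le> p \<Longrightarrow> p \<le> 1 \<Longrightarrow> branch_lim q p \<le> 1"
  using branch_reach_LIMSEQ branch_reach_le_1 by (metis LIMSEQ_le_const2)

lemma branch_lim_mono:
  assumes "0 \<le> p" "p \<le> p'" "p' \<le> 1"
  shows "branch_lim q p \<le> branch_lim q p'"
  using branch_reach_mono[OF assms] assms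
  by (intro LIMSEQ_le[OF branch_reach_LIMSEQ branch_reach_LIMSEQ]) auto

text \<open>With positive probability all edges at the root of the branch are vacant. This keeps
  jumps further along the ray visible.\<close>

lemma branch_lim_less_1:
  assumes "0 \<le> p" "p < 1"
  shows "branch_lim q p < 1"
proof -
  have "branch_reach q p (Suc 0) 0 = 1 - (1 - p) ^ branching q 0" by simp
  also have "\<dots> < 1" using assms by simp
  finally have "branch_reach q p (Suc 0) 0 < 1" .
  moreover have "branch_lim q p \<le> branch_reach q p (Suc 0) 0"
    using assms branch_reach_Suc_le by (intro decseq_ge[OF _ branch_reach_LIMSEQ] decseq_SucI) auto
  ultimately show ?thesis by linarith
qed

text \<open>With \<open>y = sqrt x\<close> the term is the square of \<open>(n + 1) * y ^ n\<close>,
  so a linear factor suffices.\<close>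

lemma square_times_geometric_LIMSEQ:
  fixes x :: real
  assumes "0 \<le> x" "x < 1"
  shows "(\<lambda>n. (real n + 1)\<^sup>2 * x ^ n) \<longlonglongrightarrow> 0"
proof -
  let ?y = "sqrt x"
  have y: "0 \<le> ?y" "?y < 1" using assms by auto
  have "(\<lambda>n. real n * ?y ^ n + ?y ^ n) \<longlonglongrightarrow> 0 + 0"
    using y by (intro tendsto_add powser_times_n_limit_0 LIMSEQ_power_zero) auto
  then have "(\<lambda>n. (real n * ?y ^ n + ?y ^ n)\<^sup>2) \<longlonglongrightarrow> (0 + 0)\<^sup>2" by (intro tendsto_power)
  moreover have "(real n * ?y ^ n + ?y ^ n)\<^sup>2 = (real n + 1)\<^sup>2 * x ^ n" for n
  proof -
    have "(?y ^ n)\<^sup>2 = (?y\<^sup>2) ^ n" by (simp only: power_mult[symmetric] mult.commute)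
    also have "\<dots> = x ^ n" using assms by simp
    finally show ?thesis
      by (metis distrib_right mult_1 power_mult_distrib)
  qed
  ultimately show ?thesis by simp
qed

text \<open>The union bound \<open>1 - (1 - x) ^ b \<le> b * x\<close>, which is Bernoulli's
  inequality. Weighting by the level size absorbs the branching numbers and leaves one factor
  \<open>p\<close> per level.\<close>

lemma branch_reach_upper:
  assumes "0 < q" "q < 1" "0 \<le> p" "p \<le> 1"
  shows "branch_reach q p n j * level_size q j \<le> p ^ n * level_size q (j + n)"
proof (induction n arbitrary: j)
  case (Suc n)
  let ?x = "p * branch_reach q p n (Suc j)" and ?b = "branching q j"
  have "?x \<le> 1"
    using assms branch_reach_nonneg branch_reach_le_1 by (intro mult_le_one) auto
  then have "branch_reach q p (Suc n) j \<le> ?b * ?x"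
    using Bernoulli_inequality[of "- ?x" ?b] by simp
  then have "branch_reach q p (Suc n) j * level_size q j \<le> ?b * ?x * level_size q j"
    by (intro mult_right_mono) auto
  also have "\<dots> = p * (branch_reach q p n (Suc j) * level_size q (Suc j))"
    using branching_mult[OF assms(1,2), of j, symmetric] by simp
  also have "\<dots> \<le> p * (p ^ n * level_size q (Suc j + n))"
    using Suc assms by (intro mult_left_mono)
  finally show ?case by simp
qed simp

lemma branch_lim_subcritical:
  assumes "0 < q" "q < 1" "0 \<le> p" "p < q"
  shows "branch_lim q p = 0"
proof -
  have "branch_reach q p n 0 \<le> (real n + 1)\<^sup>2 * (p / q) ^ n" for n
  proof -
    have "branch_reach q p n 0 \<le> p ^ n * level_size q n"
      using branch_reach_upper[of q p n 0] assms by simp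
    also have "\<dots> \<le> p ^ n * ((real n + 1)\<^sup>2 / q ^ n)"
      using assms level_size_bounds(1) by (intro mult_left_mono) auto
    finally show ?thesis by (simp add: power_divide mult.commute)
  qed
  moreover have "(\<lambda>n. (real n + 1)\<^sup>2 * (p / q) ^ n) \<longlonglongrightarrow> 0"
    using assms by (intro square_times_geometric_LIMSEQ) auto
  ultimately have "branch_lim q p \<le> 0"
    using assms by (intro LIMSEQ_le[OF branch_reach_LIMSEQ]) auto
  then show ?thesis using branch_lim_nonneg[of p q] assms by simp
qed

text \<open>In terms of \<open>1 / branch_reach\<close> the recursion becomes subadditive, because
  \<open>1 - (1 - x) ^ b \<ge> b * x / (1 + b * x)\<close>.\<close>

lemma inverse_extinction_le:
  fixes x :: real
  assumes "0 < x" "x \<le> 1" "0 < b"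
  shows "0 < 1 - (1 - x) ^ b" "1 / (1 - (1 - x) ^ b) \<le> 1 / (b * x) + 1"
proof -
  have bx: "0 < b * x" using assms by simp
  \<comment> \<open>Bernoulli replaces \<open>1 + b * x\<close> by \<open>(1 + x) ^ b\<close>, and
    the product collapses to a power of \<open>1 - x * x\<close>. Hence
    \<open>(1 - x) ^ b \<le> 1 / (1 + b * x)\<close>.\<close>
  have "(1 - x) ^ b * (1 + b * x) \<le> (1 - x) ^ b * (1 + x) ^ b"
    using assms Bernoulli_inequality[of x b] by (intro mult_left_mono) auto
  also have "\<dots> = (1 - x * x) ^ b"
    by (simp add: power_mult_distrib[symmetric] algebra_simps)
  also have "\<dots> \<le> 1" using assms by (intro power_le_one) (auto intro: mult_le_one)
  finally have *: "b * x \<le> (1 - (1 - x) ^ b) * (1 + b * x)" by (simp add: algebra_simps)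
  then show pos: "0 < 1 - (1 - x) ^ b"
    using bx by (smt (verit) mult_nonpos_nonneg)
  show "1 / (1 - (1 - x) ^ b) \<le> 1 / (b * x) + 1"
    using * pos bx by (simp add: field_simps)
qed

text \<open>Here \<open>g j\<close> is the expected number of vertices of level \<open>j\<close>
  joined to the root of the branch at \<open>p = q\<close>. Weighting by \<open>g\<close> makes
  \<open>b * x\<close> pass unchanged to the next level, so each level adds at most
  \<open>1 / g j\<close>, as for resistances in series.\<close>

lemma branch_reach_lower:
  fixes g :: "nat \<Rightarrow> real"
  assumes q: "0 < q" "q < 1" and g: "\<And>j. g j = q ^ j * level_size q j"
  shows "0 < branch_reach q q n j \<and>
    1 / (g j * branch_reach q q n j) \<le> 1 / g (j + n) + (\<Sum>l=j..<j+n. 1 / g l)"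
proof (induction n arbitrary: j)
  case (Suc n)
  let ?x = "q * branch_reach q q n (Suc j)" and ?b = "branching q j"
  have g_pos: "0 < g l" for l using q by (simp add: g)
  have x: "0 < ?x" "?x \<le> 1"
    using Suc[of "Suc j"] q branch_reach_le_1[of q q n "Suc j"] by (auto intro: mult_le_one)
  note step = inverse_extinction_le[OF x branching_pos[OF q, of j]]
  have "1 / (g j * branch_reach q q (Suc n) j) = 1 / (1 - (1 - ?x) ^ ?b) / g j"
    by simp
  also have "\<dots> \<le> (1 / (?b * ?x) + 1) / g j"
    using step g_pos[of j] by (intro divide_right_mono) auto
  also have "\<dots> = 1 / (g j * (?b * ?x)) + 1 / g j"
    by (simp add: add_divide_distrib)
  also have "g j * (?b * ?x) = g (Suc j) * branch_reach q q n (Suc j)"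
    by (simp add: g branching_mult[OF q, of j, symmetric])
  also have "1 / (g (Suc j) * branch_reach q q n (Suc j)) + 1 / g j \<le>
    1 / g (Suc j + n) + (\<Sum>l=Suc j..<Suc j+n. 1 / g l) + 1 / g j"
    using Suc[of "Suc j"] by simp
  also have "\<dots> = 1 / g (j + Suc n) + (\<Sum>l=j..<j+Suc n. 1 / g l)"
    by (simp add: sum.atLeast_Suc_lessThan[of j])
  finally show ?case using step by simp
qed (simp add: g)

lemma branch_lim_critical:
  assumes q: "0 < q" "q < 1"
  shows "0 < branch_lim q q"
proof -
  define g where "g j = q ^ j * level_size q j" for j
  \<comment> \<open>The first 2 bounds \<open>1 / g n\<close>; the rest bounds the sum of
    \<open>1 / g l \<le> 2 / (l + 1)^2\<close> by Euler's series.\<close>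
  define C where "C = 2 + 2 * (pi\<^sup>2 / 6)"
  have C: "0 < C" by (simp add: C_def add_pos_nonneg)
  have g: "1 / g l \<le> 2 * (1 / (real l + 1)\<^sup>2)" for l
  proof -
    have "(real l + 1)\<^sup>2 / 2 \<le> g l"
      using level_size_bounds(2)[OF q, of l] q by (simp add: g_def field_simps)
    then have "1 / g l \<le> 1 / ((real l + 1)\<^sup>2 / 2)" by (intro divide_left_mono) (auto simp: g_def q)
    then show ?thesis by simp
  qed
  have "1 / C \<le> branch_reach q q n 0" for n
  proof -
    have pos: "0 < branch_reach q q n 0"
      and "1 / branch_reach q q n 0 \<le> 1 / g n + (\<Sum>l=0..<n. 1 / g l)"
      using branch_reach_lower[OF q g_def, of n 0] by (auto simp: g_def)
    note this(2)
    also have "1 / g n \<le> 2"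
    proof -
      have "1 / (real n + 1)\<^sup>2 \<le> 1" by (simp add: one_le_power)
      then show ?thesis using g[of n] by linarith
    qed
    also have "(\<Sum>l=0..<n. 1 / g l) \<le> (\<Sum>l=0..<n. 2 * (1 / (real l + 1)\<^sup>2))"
      by (intro sum_mono g)
    also have "\<dots> = 2 * (\<Sum>l<n. 1 / (real l + 1)\<^sup>2)"
      by (simp add: sum_distrib_left atLeast0LessThan)
    also have "(\<Sum>l<n. 1 / (real l + 1)\<^sup>2) \<le> pi\<^sup>2 / 6"
    proof -
      have sums: "(\<lambda>l. 1 / (real l + 1)\<^sup>2) sums (pi\<^sup>2 / 6)"
        using inverse_squares_sums by (simp add: add.commute)
      show ?thesis
        using sum_le_suminf[OF sums_summable[OF sums], of "{..<n}"] sums_unique[OF sums] by simp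
    qed
    finally have "1 / branch_reach q q n 0 \<le> C" by (simp add: C_def)
    then show ?thesis using pos C by (simp add: field_simps)
  qed
  then have "1 / C \<le> branch_lim q q"
    using q by (intro LIMSEQ_le_const[OF branch_reach_LIMSEQ]) auto
  then show ?thesis using C by (smt (verit) divide_pos_pos)
qed

section \<open>Branches along a ray\<close>

text \<open>A ray vertex is itself the root of its branch, so the branch still has all
  \<open>Suc n\<close> steps to go and carries no factor \<open>p\<close>. Continuing along the ray
  uses up one edge and one step.\<close>

primrec spine_reach :: "(nat \<Rightarrow> real) \<Rightarrow> real \<Rightarrow> nat \<Rightarrow> nat \<Rightarrow> real" where
  "spine_reach q p 0 k = 1"
| "spine_reach q p (Suc n) k =
     1 - (1 - p * spine_reach q p n (Suc k)) * (1 - branch_reach (q k) p (Suc n) 0)"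

lemma spine_reach_mono:
  assumes "0 \<le> p" "p \<le> p'" "p' \<le> 1"
  shows "0 \<le> spine_reach q p n k \<and> spine_reach q p n k \<le> spine_reach q p' n k \<and>
    spine_reach q p' n k \<le> 1"
proof (induction n arbitrary: k)
  case (Suc n)
  let ?x = "p * spine_reach q p n (Suc k)" and ?y = "p' * spine_reach q p' n (Suc k)"
  let ?b = "branch_reach (q k) p (Suc n) 0" and ?c = "branch_reach (q k) p' (Suc n) 0"
  have x: "0 \<le> ?x" "?x \<le> ?y" "?y \<le> 1"
    using Suc[of "Suc k"] assms by (auto intro!: mult_mono mult_le_one)
  have b: "0 \<le> ?b" "?b \<le> ?c" "?c \<le> 1" using branch_reach_mono[OF assms] by blast+
  have "0 \<le> (1 - ?y) * (1 - ?c)" using x b by simp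
  moreover have "(1 - ?y) * (1 - ?c) \<le> (1 - ?x) * (1 - ?b)"
    using x b by (intro mult_mono) auto
  moreover have "(1 - ?x) * (1 - ?b) \<le> 1" using x b by (intro mult_le_one) auto
  ultimately show ?case by (simp only: spine_reach.simps) linarith
qed simp

lemma spine_reach_nonneg: "0 \<le> p \<Longrightarrow> p \<le> 1 \<Longrightarrow> 0 \<le> spine_reach q p n k"
  and spine_reach_le_1: "0 \<le> p \<Longrightarrow> p \<le> 1 \<Longrightarrow> spine_reach q p n k \<le> 1"
  using spine_reach_mono[of p p q n k] by auto

lemma spine_reach_Suc_le:
  assumes "0 \<le> p" "p \<le> 1"
  shows "spine_reach q p (Suc n) k \<le> spine_reach q p n k"
proof (induction n arbitrary: k)
  case 0
  show ?case using spine_reach_le_1[OF assms, of q "Suc 0" k] by simp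
next
  case (Suc n)
  let ?x = "p * spine_reach q p (Suc n) (Suc k)" and ?y = "p * spine_reach q p n (Suc k)"
  let ?b = "branch_reach (q k) p (Suc (Suc n)) 0" and ?c = "branch_reach (q k) p (Suc n) 0"
  have "?x \<le> ?y" using Suc assms by (intro mult_left_mono)
  moreover have "?y \<le> 1"
    using assms spine_reach_nonneg spine_reach_le_1 by (intro mult_le_one) auto
  moreover have "?b \<le> ?c" "?c \<le> 1"
    using branch_reach_Suc_le[OF assms] branch_reach_le_1[OF assms] by blast+
  ultimately have "(1 - ?y) * (1 - ?c) \<le> (1 - ?x) * (1 - ?b)"
    by (intro mult_mono) linarith+
  then show ?case by (subst (1 2) spine_reach.simps(2)) linarith
qed

definition spine_lim :: "(nat \<Rightarrow> real) \<Rightarrow> real \<Rightarrow> nat \<Rightarrow> real" where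
  "spine_lim q p k = lim (\<lambda>n. spine_reach q p n k)"

lemma spine_reach_LIMSEQ:
  assumes "0 \<le> p" "p \<le> 1"
  shows "(\<lambda>n. spine_reach q p n k) \<longlonglongrightarrow> spine_lim q p k"
proof -
  have "decseq (\<lambda>n. spine_reach q p n k)"
    using spine_reach_Suc_le[OF assms] by (intro decseq_SucI)
  then have "convergent (\<lambda>n. spine_reach q p n k)"
    using spine_reach_nonneg[OF assms] by (metis convergentI decseq_convergent)
  then show ?thesis by (simp add: spine_lim_def convergent_LIMSEQ_iff)
qed

lemma spine_lim_bounds:
  assumes "0 \<le> p" "p \<le> 1"
  shows "0 \<le> spine_lim q p k" "spine_lim q p k \<le> 1"
  using spine_reach_nonneg[OF assms] spine_reach_le_1[OF assms]
  by (auto intro: LIMSEQ_le_const[OF spine_reach_LIMSEQ[OF assms]]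
      LIMSEQ_le_const2[OF spine_reach_LIMSEQ[OF assms]])

lemma spine_lim_mono:
  assumes "0 \<le> p" "p \<le> p'" "p' \<le> 1"
  shows "spine_lim q p k \<le> spine_lim q p' k"
  using spine_reach_mono[OF assms] assms
  by (intro LIMSEQ_le[OF spine_reach_LIMSEQ spine_reach_LIMSEQ]) auto

text \<open>All later facts on \<open>spine_lim\<close> follow from this recursion together with the
  bounds and monotonicity above.\<close>

lemma spine_lim_rec:
  assumes "0 \<le> p" "p \<le> 1"
  shows "spine_lim q p k = 1 - (1 - p * spine_lim q p (Suc k)) * (1 - branch_lim (q k) p)"
proof (rule LIMSEQ_unique)
  show "(\<lambda>n. spine_reach q p (Suc n) k) \<longlonglongrightarrow> spine_lim q p k"
    by (rule LIMSEQ_Suc[OF spine_reach_LIMSEQ[OF assms]])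
  show "(\<lambda>n. spine_reach q p (Suc n) k) \<longlonglongrightarrow>
    1 - (1 - p * spine_lim q p (Suc k)) * (1 - branch_lim (q k) p)"
    unfolding spine_reach.simps(2)
    by (intro tendsto_intros spine_reach_LIMSEQ LIMSEQ_Suc[OF branch_reach_LIMSEQ] assms)
qed

text \<open>Backward induction from \<open>k\<close> to the root. At \<open>k\<close>, branch
  \<open>k\<close> contributes nothing to the left of its threshold and a fixed positive amount at
  it; every step towards the root shrinks the gap by a positive factor. The constant
  \<open>c\<close> is uniform in \<open>p\<close>, which is what excludes continuity.\<close>

lemma spine_lim_jump:
  assumes q: "0 < q k" "q k < 1" and "i \<le> k"
  shows "\<exists>c>0. \<forall>p. 0 \<le> p \<and> p < q k \<longrightarrow> spine_lim q p i + c \<le> spine_lim q (q k) i"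
  using assms(3)
proof (induction rule: inc_induct)
  case base
  define y where "y = q k * spine_lim q (q k) (Suc k)"
  define b where "b = branch_lim (q k) (q k)"
  \<comment> \<open>The ray edge beyond vertex \<open>k\<close> is vacant with positive probability,
    so \<open>y < 1\<close> and the branch gets a positive weight \<open>1 - y\<close>.\<close>
  have "y \<le> q k * 1"
    unfolding y_def using q spine_lim_bounds(2)[of "q k"] by (intro mult_left_mono) auto
  then have "0 < (1 - y) * b" using q branch_lim_critical[OF q] by (simp add: b_def)
  moreover have "spine_lim q p k + (1 - y) * b \<le> spine_lim q (q k) k" if p: "0 \<le> p" "p < q k" for p
  proof -
    have "spine_lim q p k = p * spine_lim q p (Suc k)"
      using spine_lim_rec[of p q k] branch_lim_subcritical[OF q p] p q by simp
    also have "\<dots> \<le> y"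
      unfolding y_def using p q spine_lim_mono[of p "q k"] spine_lim_bounds(1)[of p]
      by (intro mult_mono) auto
    finally show ?thesis
      using spine_lim_rec[of "q k" q k] q by (simp add: y_def[symmetric] b_def[symmetric] algebra_simps)
  qed
  ultimately show ?case by blast
next
  case (step i)
  then obtain c where c: "0 < c"
    "\<And>p. 0 \<le> p \<Longrightarrow> p < q k \<Longrightarrow> spine_lim q p (Suc i) + c \<le> spine_lim q (q k) (Suc i)" by blast
  define b where "b = branch_lim (q i) (q k)"
  have b: "b < 1" using branch_lim_less_1 q by (simp add: b_def)
  \<comment> \<open>The gap is seen only if the edge to vertex \<open>Suc i\<close> is occupied
    (factor \<open>q k\<close>) and branch \<open>i\<close> does not percolate already (factor
    \<open>1 - b\<close>).\<close>
  have "spine_lim q p i + q k * c * (1 - b) \<le> spine_lim q (q k) i" if p: "0 \<le> p" "p < q k" for p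
  proof -
    define x where "x = p * spine_lim q p (Suc i)"
    define y where "y = q k * spine_lim q (q k) (Suc i)"
    have "p * spine_lim q p (Suc i) \<le> q k * spine_lim q p (Suc i)"
      using p q spine_lim_bounds(1)[of p q "Suc i"] by (intro mult_right_mono) auto
    moreover have "q k * (spine_lim q p (Suc i) + c) \<le> y"
      unfolding y_def using c(2)[OF p] q by (intro mult_left_mono) auto
    ultimately have "x + q k * c \<le> y" by (simp add: x_def distrib_left)
    then have "(q k * c) * (1 - b) \<le> (y - x) * (1 - b)"
      using b by (intro mult_right_mono) auto
    \<comment> \<open>By monotonicity, branch \<open>i\<close> may be evaluated at
      \<open>q k\<close> on both sides; this only narrows the gap to be estimated.\<close>
    moreover have "(1 - x) * (1 - b) \<le> (1 - x) * (1 - branch_lim (q i) p)"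
    proof (rule mult_left_mono)
      show "1 - b \<le> 1 - branch_lim (q i) p"
        using branch_lim_mono[of p "q k" "q i"] p q by (simp add: b_def)
      show "0 \<le> 1 - x"
        using p q spine_lim_bounds[of p q "Suc i"] by (simp add: x_def mult_le_one)
    qed
    ultimately show ?thesis
      using spine_lim_rec[of p q i] spine_lim_rec[of "q k" q i] p q
      by (simp add: x_def[symmetric] y_def[symmetric] b_def[symmetric] algebra_simps)
  qed
  moreover have "0 < q k * c * (1 - b)" using q c b by simp
  ultimately show ?case by blast
qed

lemma spine_lim_ge_step:
  assumes "0 \<le> p" "p \<le> 1"
  shows "p * spine_lim q p (Suc k) \<le> spine_lim q p k" "branch_lim (q k) p \<le> spine_lim q p k"
proof -
  define x where "x = p * spine_lim q p (Suc k)"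
  define b where "b = branch_lim (q k) p"
  have x: "0 \<le> x" "x \<le> 1"
    using assms spine_lim_bounds[of p q "Suc k"] by (auto simp: x_def mult_le_one)
  have b: "0 \<le> b" "b \<le> 1"
    using assms branch_lim_nonneg branch_lim_le_1 by (auto simp: b_def)
  have *: "spine_lim q p k = x + b * (1 - x)" "spine_lim q p k = b + x * (1 - b)"
    using spine_lim_rec[of p q k] assms by (simp_all add: x_def b_def algebra_simps)
  show "p * spine_lim q p (Suc k) \<le> spine_lim q p k" "branch_lim (q k) p \<le> spine_lim q p k"
    unfolding x_def[symmetric] b_def[symmetric]
    using * mult_nonneg_nonneg[of b "1 - x"] mult_nonneg_nonneg[of x "1 - b"] x b by linarith+
qed

lemma spine_lim_supercritical:
  assumes q: "0 < q k" "q k < 1" "q k \<le> p" "p \<le> 1"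
  shows "0 < spine_lim q p 0"
proof -
  have "0 < spine_lim q p i" if "i \<le> k" for i
    using that
  proof (induction rule: inc_induct)
    case base
    have "0 < branch_lim (q k) (q k)" using branch_lim_critical q by simp
    also have "\<dots> \<le> branch_lim (q k) p" using q by (intro branch_lim_mono) auto
    also have "\<dots> \<le> spine_lim q p k" using q by (intro spine_lim_ge_step) auto
    finally show ?case .
  next
    case (step i)
    then have "0 < p * spine_lim q p (Suc i)" using q by simp
    also have "\<dots> \<le> spine_lim q p i" using q by (intro spine_lim_ge_step) auto
    finally show ?case .
  qed
  then show ?thesis by simp
qed

text \<open>When no branch percolates, only the ray could lead to infinity, and every edge of it
  costs a factor \<open>p < 1\<close>.\<close>

lemma spine_lim_subcritical:
  assumes q: "\<And>k. 0 < q k" "\<And>k. q k < 1" and p: "0 \<le> p" "\<And>k. p < q k"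
  shows "spine_lim q p 0 = 0"
proof -
  have p1: "p < 1" using q(2) p(2) less_trans by blast
  have step: "spine_lim q p k = p * spine_lim q p (Suc k)" for k
    using spine_lim_rec[of p q k] branch_lim_subcritical[OF q p] p p1 by simp
  have iter: "spine_lim q p 0 = p ^ m * spine_lim q p m" for m
  proof (induction m)
    case (Suc m)
    then show ?case by (simp add: step[of m] mult_ac)
  qed simp
  have "spine_lim q p 0 \<le> p ^ m" for m
    using iter[of m] mult_left_mono[of "spine_lim q p m" 1 "p ^ m"] spine_lim_bounds[of p q m] p p1
    by simp
  moreover have "(\<lambda>m. p ^ m) \<longlonglongrightarrow> 0" using p p1 by (intro LIMSEQ_power_zero) auto
  ultimately have "spine_lim q p 0 \<le> 0" by (intro LIMSEQ_le_const) auto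
  then show ?thesis using spine_lim_bounds[of p q 0] p p1 by simp
qed

section \<open>The tree\<close>

text \<open>The vertices \<open>(k, 0, 0)\<close> form a ray, and the vertices \<open>(k, j, i)\<close> with fixed \<open>k\<close> form
  level \<open>j\<close> of a spherically symmetric tree rooted at \<open>(k, 0, 0)\<close>.\<close>

definition nodes :: "(nat \<Rightarrow> real) \<Rightarrow> (nat \<times> nat \<times> nat) set" where
  "nodes q = {(k, j, i). i < level_size (q k) j}"

text \<open>Truncated subtraction makes the root its own parent, which is why the root is removed
  wherever children are formed.\<close>

definition node_par :: "(nat \<Rightarrow> real) \<Rightarrow> nat \<times> nat \<times> nat \<Rightarrow> nat \<times> nat \<times> nat" where
  "node_par q = (\<lambda>(k, j, i). case j of 0 \<Rightarrow> (k - 1, 0, 0)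
     | Suc j' \<Rightarrow> (k, j', i mod level_size (q k) j'))"

definition node_ht :: "nat \<times> nat \<times> nat \<Rightarrow> nat" where
  "node_ht = (\<lambda>(k, j, i). k + j)"

lemma node_children:
  assumes "i < level_size (q k) j"
  shows "{w \<in> nodes q - {(0, 0, 0)}. node_par q w = (k, j, i)} =
    (\<lambda>i'. (k, Suc j, i')) ` {i' \<in> {..<level_size (q k) (Suc j)}. i' mod level_size (q k) j = i} \<union>
    (if j = 0 then {(Suc k, 0, 0)} else {})"
  using assms by (auto simp: nodes_def node_par_def split: nat.splits)

locale spine_tree =
  fixes q :: "nat \<Rightarrow> real"
  assumes q_pos: "0 < q k" and q_less_1: "q k < 1"
begin

text \<open>The tree is transported along \<open>to_nat\<close> because its vertices are to be
  natural numbers.\<close>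

definition vertex_par :: "nat \<Rightarrow> nat" where
  "vertex_par v = to_nat (node_par q (from_nat v))"

lemma vertex_children:
  "{w \<in> to_nat ` nodes q - {to_nat (0::nat, 0::nat, 0::nat)}. vertex_par w = to_nat x} =
    to_nat ` {w \<in> nodes q - {(0, 0, 0)}. node_par q w = x}"
  by (auto simp: vertex_par_def)

sublocale rooted_tree "to_nat ` nodes q" "to_nat (0::nat, 0::nat, 0::nat)" vertex_par
  "\<lambda>v. node_ht (from_nat v)"
proof
  show "to_nat (0::nat, 0::nat, 0::nat) \<in> to_nat ` nodes q" by (auto simp: nodes_def)
  show "node_ht (from_nat (to_nat (0::nat, 0::nat, 0::nat))) = 0" by (simp add: node_ht_def)
next
  fix v assume v: "v \<in> to_nat ` nodes q" "v \<noteq> to_nat (0::nat, 0::nat, 0::nat)"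
  then obtain k j i where kji: "v = to_nat (k, j, i)" "i < level_size (q k) j"
    by (auto simp: nodes_def)
  have "node_par q (k, j, i) \<in> nodes q"
    by (auto simp: nodes_def node_par_def split: nat.splits)
  then show "vertex_par v \<in> to_nat ` nodes q" by (simp add: kji vertex_par_def)
  show "node_ht (from_nat v) = Suc (node_ht (from_nat (vertex_par v)))"
    using v(2) kji by (auto simp: node_ht_def node_par_def vertex_par_def split: nat.splits)
next
  fix v assume "v \<in> to_nat ` nodes q"
  then obtain k j i where "v = to_nat (k, j, i)" "i < level_size (q k) j"
    by (auto simp: nodes_def)
  then show "finite {w \<in> to_nat ` nodes q - {to_nat (0::nat, 0::nat, 0::nat)}. vertex_par w = v}"
    by (simp only: vertex_children node_children) simp
qed

lemma prod_children:
  fixes f :: "nat \<Rightarrow> real"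
  assumes "i < level_size (q k) j"
    and const: "\<And>i'. i' < level_size (q k) (Suc j) \<Longrightarrow> f (to_nat (k, Suc j, i')) = c"
  shows "(\<Prod>w\<in>children (to_nat (k, j, i)). f w) =
    c ^ branching (q k) j * (if j = 0 then f (to_nat (Suc k, 0::nat, 0::nat)) else 1)"
proof -
  let ?F = "{i' \<in> {..<level_size (q k) (Suc j)}. i' mod level_size (q k) j = i}"
  let ?A = "(\<lambda>i'. (k, Suc j, i')) ` ?F" and ?B = "if j = 0 then {(Suc k, 0 :: nat, 0 :: nat)} else {}"
  have "(\<Prod>w\<in>children (to_nat (k, j, i)). f w) = (\<Prod>x\<in>?A \<union> ?B. f (to_nat x))"
    unfolding children_def vertex_children node_children[of i q k j, OF assms(1)]
    by (subst prod.reindex) (auto intro: inj_on_subset[OF inj_to_nat])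
  also have "\<dots> = (\<Prod>x\<in>?A. f (to_nat x)) * (\<Prod>x\<in>?B. f (to_nat x))"
    by (rule prod.union_disjoint) auto
  also have "(\<Prod>x\<in>?A. f (to_nat x)) = (\<Prod>i'\<in>?F. f (to_nat (k, Suc j, i')))"
    by (subst prod.reindex) (auto intro: inj_onI)
  also have "\<dots> = c ^ branching (q k) j"
    using const card_level_fibre[OF q_pos q_less_1 assms(1)] by simp
  finally show ?thesis by simp
qed

text \<open>Restricted to levels \<open>Suc j\<close>: at level 0 there is one more child, the next
  vertex of the ray.\<close>

lemma reach_branch:
  "i < level_size (q k) (Suc j) \<Longrightarrow>
    reach p n (to_nat (k, Suc j, i)) = branch_reach (q k) p n (Suc j)"
proof (induction n arbitrary: j i)
  case (Suc n)
  then show ?case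
    using prod_children[of i k "Suc j" "\<lambda>w. 1 - p * reach p n w"] by simp
qed simp

lemma reach_spine: "reach p n (to_nat (k, 0::nat, 0::nat)) = spine_reach q p n k"
proof (induction n arbitrary: k)
  case (Suc n)
  have "(\<Prod>w\<in>children (to_nat (k, 0::nat, 0::nat)). 1 - p * reach p n w) =
    (1 - p * branch_reach (q k) p n (Suc 0)) ^ branching (q k) 0 * (1 - p * spine_reach q p n (Suc k))"
    using prod_children[of 0 k 0 "\<lambda>w. 1 - p * reach p n w"] Suc reach_branch by simp
  then show ?case by (simp add: mult.commute)
qed simp

lemma density_eq:
  assumes "0 \<le> p" "p \<le> 1"
  shows "percolation_density edges (to_nat (0::nat, 0::nat, 0::nat)) p = spine_lim q p 0"
  using density_LIMSEQ[OF assms] spine_reach_LIMSEQ[OF assms]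
  unfolding reach_spine by (rule LIMSEQ_unique)

lemma infinite_vertices: "infinite (to_nat ` nodes q)"
proof -
  have "range (\<lambda>k::nat. to_nat (k, 0::nat, 0::nat)) \<subseteq> to_nat ` nodes q"
    by (intro image_subsetI imageI) (simp add: nodes_def)
  moreover have "infinite (range (\<lambda>k::nat. to_nat (k, 0::nat, 0::nat)))"
    by (intro range_inj_infinite injI) simp
  ultimately show ?thesis using finite_subset by blast
qed

text \<open>The uniform gap keeps the left limit at \<open>q k\<close> at least \<open>c\<close>
  below the value there.\<close>

lemma density_not_isCont:
  "\<not> isCont (percolation_density edges (to_nat (0::nat, 0::nat, 0::nat))) (q k)"
  (is "\<not> isCont ?\<theta> _")
proof
  assume "isCont ?\<theta> (q k)"
  then have lim: "(?\<theta> \<longlongrightarrow> ?\<theta> (q k)) (at_left (q k))"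
    by (auto simp: isCont_def intro: filterlim_mono at_le)
  obtain c where c: "0 < c"
    "\<And>p. 0 \<le> p \<Longrightarrow> p < q k \<Longrightarrow> spine_lim q p 0 + c \<le> spine_lim q (q k) 0"
    using spine_lim_jump[of q k 0] q_pos q_less_1 by blast
  have "eventually (\<lambda>p. ?\<theta> p \<le> ?\<theta> (q k) - c) (at_left (q k))"
  proof (rule eventually_at_leftI)
    fix p assume "p \<in> {0<..<q k}"
    then show "?\<theta> p \<le> ?\<theta> (q k) - c"
      using c(2)[of p] q_less_1[of k] by (simp add: density_eq)
  qed (rule q_pos)
  then have "?\<theta> (q k) \<le> ?\<theta> (q k) - c"
    by (intro tendsto_upperbound[OF lim]) auto
  then show False using c(1) by simp
qed

end

section \<open>From dense jumps to failure of analyticity\<close>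

lemma analytic_at_within_imp_isCont_left:
  assumes "analytic_at_within f {a<..b} x" "x \<in> {a<..b}"
  obtains c where "a \<le> c" "c < x" "\<And>y. c < y \<Longrightarrow> y < x \<Longrightarrow> isCont f y"
proof -
  obtain r g where r: "0 < r" and g: "g holomorphic_on ball (complex_of_real x) r"
    and eq: "\<And>y. y \<in> {a<..b} \<Longrightarrow> complex_of_real y \<in> ball (complex_of_real x) r \<Longrightarrow>
      g (complex_of_real y) = complex_of_real (f y)"
    using assms(1) unfolding analytic_at_within_def by blast
  \<comment> \<open>Working only to the left of \<open>x\<close>, inside both the disc and the
    interval, also covers the right endpoint, where the holomorphic function agrees with
    \<open>f\<close> on one side only.\<close>
  define c where "c = max a (x - r)"
  have ball: "complex_of_real y \<in> ball (complex_of_real x) r" if "y \<in> {c<..<x}" for y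
    using that by (simp add: c_def dist_of_real dist_real_def)
  have "continuous_on {c<..<x} (\<lambda>y. Re (g (complex_of_real y)))"
    using ball by (intro continuous_on_Re continuous_on_compose2[OF
          holomorphic_on_imp_continuous_on[OF g]] continuous_intros) auto
  moreover have "Re (g (complex_of_real y)) = f y" if "y \<in> {c<..<x}" for y
    using eq[OF _ ball[OF that]] that assms(2) by (simp add: c_def)
  ultimately have "continuous_on {c<..<x} f" by (rule continuous_on_eq)
  then have "isCont f y" if "c < y" "y < x" for y
    using that by (simp add: continuous_on_eq_continuous_at)
  moreover have "a \<le> c" "c < x" using r assms(2) by (auto simp: c_def)
  ultimately show thesis using that by blast
qed

theorem mainTheorem5:
  "\<exists>(V :: nat set) (E :: nat set set) (root :: nat).
     is_tree V E \<and> infinite V \<and> locally_finite_graph V E \<and> root \<in> V \<and>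
     critical_prob E root = 1 / 2 \<and>
     nowhere_analytic_on (percolation_density E root) {critical_prob E root <.. 1} \<and>
     (\<forall>p \<in> {critical_prob E root <..< 1} \<inter> \<rat>.
        \<not> percolation_density E root differentiable (at p))"
proof -
  define Q where "Q = {1/2<..<1} \<inter> (\<rat> :: real set)"
  have rat_between: "\<exists>s\<in>Q. a < s \<and> s < b" if "1/2 \<le> a" "a < b" "b \<le> 1" for a b :: real
    using Rats_dense_in_real[OF that(2)] that by (force simp: Q_def)
  have "countable Q" unfolding Q_def by (intro countable_Int2 countable_rat)
  moreover have "Q \<noteq> {}" using rat_between[of "1/2" 1] by auto
  ultimately obtain q :: "nat \<Rightarrow> real" where q: "range q = Q"
    using that[of "from_nat_into Q"] by simp
  have q_mem: "1/2 < q k" "q k < 1" for k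
    using q by (auto simp: Q_def)
  interpret spine_tree q
  proof
    show "0 < q k" "q k < 1" for k using q_mem[of k] by auto
  qed
  let ?r = "to_nat (0::nat, 0::nat, 0::nat)"
  let ?\<theta> = "percolation_density edges ?r"
  have sub: "?\<theta> p = 0" if "0 \<le> p" "p \<le> 1/2" for p
  proof -
    have "p < q k" for k using that q_mem(1)[of k] by linarith
    then show ?thesis
      using that q_pos q_less_1 by (simp add: density_eq spine_lim_subcritical)
  qed
  have super: "?\<theta> p \<noteq> 0" if p: "1/2 < p" "p \<le> 1" for p
  proof -
    obtain k where "q k < p" using rat_between[of "1/2" p] p q by (metis imageE less_imp_le order_refl)
    then have "0 < spine_lim q p 0" using p q_pos q_less_1 by (intro spine_lim_supercritical[of q k]) auto
    then show ?thesis using p by (simp add: density_eq)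
  qed
  have pc: "critical_prob edges ?r = 1/2"
    unfolding critical_prob_def
  \<comment> \<open>The supremum is attained: every \<open>q k\<close> exceeds 1/2 strictly, so the
    density still vanishes at 1/2 itself.\<close>
  proof (rule cSup_eq_maximum)
    show "1/2 \<in> {p \<in> {0..1}. ?\<theta> p = 0}" using sub by simp
    fix p assume p: "p \<in> {p \<in> {0..1}. ?\<theta> p = 0}"
    show "p \<le> 1/2"
      using p super[of p] by force
  qed
  have disc: "\<not> isCont ?\<theta> s" if "s \<in> Q" for s
    using that q density_not_isCont by auto
  have "nowhere_analytic_on ?\<theta> {1/2<..1}"
    unfolding nowhere_analytic_on_def
  proof
    fix x :: real assume x: "x \<in> {1/2<..1}"
    show "\<not> analytic_at_within ?\<theta> {1/2<..1} x"
    proof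
      assume "analytic_at_within ?\<theta> {1/2<..1} x"
      then obtain c where c: "1/2 \<le> c" "c < x" "\<And>y. c < y \<Longrightarrow> y < x \<Longrightarrow> isCont ?\<theta> y"
        using x by (rule analytic_at_within_imp_isCont_left) blast
      with rat_between[of c x] x disc show False by auto
    qed
  qed
  moreover have "\<not> ?\<theta> differentiable (at s)" if "s \<in> {1/2<..<1} \<inter> \<rat>" for s
    using disc[of s] that differentiable_imp_continuous_within unfolding Q_def by blast
  ultimately show ?thesis
    using tree_edges infinite_vertices locally_finite_edges root_in pc by (metis (no_types, lifting))
qed

end
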